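(* Let $\Phi_1$ and $\Phi_2$ be two growth functions in $\mathscr{U}$. Assume that $\Phi_1$ satisfies the $\nabla_2$-condition and that $\frac{\Phi_2}{\Phi_1}$ is nondecreasing. Let $\mu$ be a positive Borel measure on $\mathbb{C}_+$ and let $\alpha>-1$. Then the following assertions are equivalent. (a) There exists a constant $C_1>0$ such that for any interval $I\subset \mathbb{R}$, $\mu(Q_I)\le \dfrac{C_1}{\Phi_2\circ\Phi_1^{-1}\left(\frac{1}{|I|^{2+\alpha}}\right)}$. (b) There exists a constant $C_2>0$ such that for any $f\in A_\alpha^{\Phi_1}(\mathbb{C}_+)$, $f\neq 0$, $$\sup_{\lambda>0}\Phi_2(\lambda)\,\mu\left(\left\{z\in \mathbb{C}_+:\,|f(z)|>C_2\lambda\|f\|_{\Phi_1,\alpha}^{lux} \right\}\right)\le 1.$$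
   Context: $\mathbb{C}_+=\{x+iy: y>0\}$. A growth function is a continuous nondecreasing function from $[0,\infty)$ onto $[0,\infty)$; $\Phi^{-1}$ is its inverse. $\mathscr{U}^q$ ($q\ge1$) is the set of growth functions $\Phi$ with $\Phi(st)\le Ct^q\Phi(s)$ for $s>0,t\ge1$ and $t\mapsto\Phi(t)/t$ nondecreasing; $\mathscr{U}=\bigcup_{q\ge1}\mathscr{U}^q$. A growth function satisfies the $\nabla_2$-condition if both it and its complementary function $\Psi(s)=\sup_{t\ge0}\{ts-\Phi(t)\}$ satisfy $F(2t)\le KF(t)$ for some $K>1$, all $t\ge0$. $Q_I=\{x+iy:x\in I,0<y<|I|\}$. $dV_\alpha(x+iy)=y^\alpha dxdy$; $A^\Phi_\alpha(\mathbb{C}_+)$: holomorphic $f$ with $\int\Phi(|f|)dV_\alpha<\infty$, with $\|f\|^{lux}_{\Phi,\alpha}=\inf\{\lambda>0:\int_{\mathbb{C}_+}\Phi(|f|/\lambda)dV_\alpha\le1\}$. *)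

theory Defs
  imports "HOL-Complex_Analysis.Complex_Analysis"
begin

definition upper_half :: "complex set" where
  "upper_half = {z. Im z > 0}"

definition growth_function :: "(real \<Rightarrow> real) \<Rightarrow> bool" where
  "growth_function \<Phi> \<longleftrightarrow>
     continuous_on {0..} \<Phi> \<and> mono_on {0..} \<Phi> \<and> \<Phi> ` {0..} = {0..}"

text \<open>Inverse of a growth function (well defined when it is strictly increasing,
  which is the case for functions in the class U).\<close>
definition growth_inv :: "(real \<Rightarrow> real) \<Rightarrow> real \<Rightarrow> real" where
  "growth_inv \<Phi> y = (THE t. t \<ge> 0 \<and> \<Phi> t = y)"

definition class_U_q :: "real \<Rightarrow> (real \<Rightarrow> real) \<Rightarrow> bool" where
  "class_U_q q \<Phi> \<longleftrightarrow> growth_function \<Phi> \<and>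
     (\<exists>C. \<forall>s>0. \<forall>t\<ge>1. \<Phi> (s * t) \<le> C * t powr q * \<Phi> s) \<and>
     mono_on {0<..} (\<lambda>t. \<Phi> t / t)"

definition class_U :: "(real \<Rightarrow> real) \<Rightarrow> bool" where
  "class_U \<Phi> \<longleftrightarrow> (\<exists>q\<ge>1. class_U_q q \<Phi>)"

definition complementary :: "(real \<Rightarrow> real) \<Rightarrow> real \<Rightarrow> real" where
  "complementary \<Phi> s = (SUP t\<in>{0..}. t * s - \<Phi> t)"

definition doubling :: "(real \<Rightarrow> real) \<Rightarrow> bool" where
  "doubling F \<longleftrightarrow> (\<exists>K>1. \<forall>t\<ge>0. F (2 * t) \<le> K * F t)"

definition nabla2 :: "(real \<Rightarrow> real) \<Rightarrow> bool" where
  "nabla2 \<Phi> \<longleftrightarrow> doubling \<Phi> \<and>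
     (\<forall>s\<ge>0. bdd_above ((\<lambda>t. t * s - \<Phi> t) ` {0..})) \<and>
     doubling (complementary \<Phi>)"

definition carleson_box :: "real \<Rightarrow> real \<Rightarrow> complex set" where
  "carleson_box a b = {z. Re z \<in> {a..b} \<and> 0 < Im z \<and> Im z < b - a}"

definition orlicz_int :: "(real \<Rightarrow> real) \<Rightarrow> real \<Rightarrow> (complex \<Rightarrow> complex) \<Rightarrow> ennreal" where
  "orlicz_int \<Phi> \<alpha> f =
     (\<integral>\<^sup>+ z. indicator upper_half z * ennreal (Im z powr \<alpha>) * ennreal (\<Phi> (cmod (f z))) \<partial>lborel)"

definition bergman_orlicz :: "(real \<Rightarrow> real) \<Rightarrow> real \<Rightarrow> (complex \<Rightarrow> complex) set" where
  "bergman_orlicz \<Phi> \<alpha> = {f. f holomorphic_on upper_half \<and> orlicz_int \<Phi> \<alpha> f < \<infinity>}"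

definition lux_norm :: "(real \<Rightarrow> real) \<Rightarrow> real \<Rightarrow> (complex \<Rightarrow> complex) \<Rightarrow> real" where
  "lux_norm \<Phi> \<alpha> f = Inf {r. r > 0 \<and> orlicz_int \<Phi> \<alpha> (\<lambda>z. f z / complex_of_real r) \<le> 1}"

end

theory Submission
  imports Defs
begin

text \<open>
  A function of class U has nondecreasing quotient \<open>\<Phi> t / t\<close>, so \<open>t \<le> s + s \<Phi> t / \<Phi> s\<close> for all
  \<open>s > 0\<close>; this replaces Jensen's inequality. Combined with the area mean value inequality on the
  disc \<open>D\<^sub>z\<close> of radius \<open>y / 2\<close> about \<open>z = x + iy\<close>, it shows that \<open>|f z| > 2\<lambda>\<close> forces
  \<open>\<Phi>\<^sub>1 \<lambda> \<le> K y\<^bsup>-2-\<alpha>\<^esup> \<integral> \<Phi>\<^sub>1 |f| dV\<^sub>\<alpha>\<close>, the integral being over \<open>D\<^sub>z\<close>.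
  Integrating this over \<open>{|f| > 2\<lambda>}\<close> against \<open>\<mu>\<close> and exchanging the integrals leaves, for each \<open>w\<close>, the
  \<open>\<mu>\<close>-measure of the \<open>z\<close> with \<open>w \<in> D\<^sub>z\<close>, which lie in the Carleson box over \<open>[Re w - Im w, Re w + Im w]\<close>.
  The Carleson condition and the monotonicity of \<open>\<Phi>\<^sub>2 / \<Phi>\<^sub>1\<close> then give the weak type bound.
  Conversely, one tests the weak type bound on \<open>s (h / (z - p))\<^sup>m\<close> with \<open>p\<close> the point at depth
  \<open>h = |I|\<close> below the centre of \<open>I\<close> and \<open>s = \<Phi>\<^sub>1\<^sup>-\<^sup>1 (h\<^bsup>-2-\<alpha>\<^esup>)\<close>.
\<close>

section \<open>Planar Lebesgue measure in coordinates and under rotations\<close>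

text \<open>The map \<open>?c\<close> carries Lebesgue measure on real pairs to
  \<open>lborel\<close> on the plane, because both agree on boxes; Tonelli for the product measure
  then gives either order.\<close>

lemma nn_integral_lborel_complex:
  fixes g :: "complex \<Rightarrow> ennreal"
  assumes [measurable]: "g \<in> borel_measurable borel"
  shows "(\<integral>\<^sup>+z. g z \<partial>lborel) = (\<integral>\<^sup>+y. \<integral>\<^sup>+x. g (Complex x y) \<partial>lborel \<partial>lborel)"
    and "(\<integral>\<^sup>+z. g z \<partial>lborel) = (\<integral>\<^sup>+x. \<integral>\<^sup>+y. g (Complex x y) \<partial>lborel \<partial>lborel)"
proof -
  let ?c = "\<lambda>p::real \<times> real. Complex (fst p) (snd p)"
  have c[measurable]: "?c \<in> borel_measurable borel"
    by (intro borel_measurable_continuous_onI) (auto intro!: continuous_intros simp: Complex_eq)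
  have lb: "lborel = distr (lborel :: (real \<times> real) measure) borel ?c"
  proof (rule lborel_eqI)
    fix l u :: complex
    assume le: "\<And>b. b \<in> Basis \<Longrightarrow> l \<bullet> b \<le> u \<bullet> b"
    have "?c -` box l u = box (Re l, Im l) (Re u, Im u)"
      by (auto simp: box_def Basis_complex_def Basis_prod_def)
    then show "emeasure (distr lborel borel ?c) (box l u) = (\<Prod>b\<in>Basis. (u - l) \<bullet> b)"
      using le[of 1] le[of \<i>]
      by (subst emeasure_distr)
         (auto simp: Basis_complex_def Basis_prod_def emeasure_lborel_box_eq ennreal_mult
           mult.commute
           intro!: borel_measurable_continuous_onI continuous_intros)
  qed simp
  have "integral\<^sup>N (distr (lborel :: (real \<times> real) measure) borel ?c) g = (\<integral>\<^sup>+p. g (?c p) \<partial>lborel)"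
    by (rule nn_integral_distr) auto
  then have eq: "(\<integral>\<^sup>+z. g z \<partial>lborel) = (\<integral>\<^sup>+p. g (?c p) \<partial>(lborel \<Otimes>\<^sub>M lborel))"
    unfolding lborel_prod lb[symmetric] .
  have m: "(\<lambda>p. g (?c p)) \<in> borel_measurable (lborel \<Otimes>\<^sub>M lborel)"
    unfolding lborel_prod by measurable
  show "(\<integral>\<^sup>+z. g z \<partial>lborel) = (\<integral>\<^sup>+x. \<integral>\<^sup>+y. g (Complex x y) \<partial>lborel \<partial>lborel)"
    unfolding eq using lborel.nn_integral_fst[OF m] by simp
  show "(\<integral>\<^sup>+z. g z \<partial>lborel) = (\<integral>\<^sup>+y. \<integral>\<^sup>+x. g (Complex x y) \<partial>lborel \<partial>lborel)"
    unfolding eq using lborel_pair.nn_integral_snd[OF m] by simp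
qed

lemma borel_measurable_Complex [measurable (raw)]:
  assumes "f \<in> borel_measurable M" "g \<in> borel_measurable M"
  shows "(\<lambda>x. Complex (f x) (g x)) \<in> borel_measurable M"
  using assms by (simp add: borel_measurable_complex_iff)

text \<open>Affine substitutions in one real variable at a time. The invariance later turns averages
  over circles into an average over a disc.\<close>

lemma nn_integral_lborel_rotation:
  fixes g :: "complex \<Rightarrow> ennreal"
  assumes [measurable]: "g \<in> borel_measurable borel" and u: "cmod u = 1"
  shows "(\<integral>\<^sup>+z. g (u * z) \<partial>lborel) = (\<integral>\<^sup>+z. g z \<partial>lborel)"
proof -
  obtain c s where cs: "u = Complex c s" by (cases u)
  have 1: "c * c + s * s = 1"
    using u by (simp add: cs cmod_def power2_eq_square)
  have m: "(\<lambda>z. g (u * z)) \<in> borel_measurable borel" by measurable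
  show ?thesis
  proof (cases "c = 0")
    \<comment> \<open>A quarter turn swaps the axes up to sign, so each variable needs only a
      scaling by 1 or -1.\<close>
    case True
    have [simp]: "s \<noteq> 0" "\<bar>s\<bar> = 1" using 1 True by (auto simp: square_eq_1_iff)
    have "(\<integral>\<^sup>+z. g (u * z) \<partial>lborel) = (\<integral>\<^sup>+y. \<integral>\<^sup>+x. g (Complex (0 + (-s) * y) (0 + s * x)) \<partial>lborel \<partial>lborel)"
      by (subst nn_integral_lborel_complex(1)[OF m]) (simp add: cs True complex_eq_iff times_complex.ctr)
    also have "\<dots> = (\<integral>\<^sup>+y. \<integral>\<^sup>+x. g (Complex (0 + (-s) * y) x) \<partial>lborel \<partial>lborel)"
      by (subst (2) nn_integral_real_affine[where c = s and t = 0]) auto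
    also have "\<dots> = (\<integral>\<^sup>+y. \<integral>\<^sup>+x. g (Complex y x) \<partial>lborel \<partial>lborel)"
      by (subst (3) nn_integral_real_affine[where c = "-s" and t = 0]) auto
    finally show ?thesis by (simp add: nn_integral_lborel_complex(2))
  next
    case False
    \<comment> \<open>Substitute first the real part \<open>x' = c x - s y\<close> for fixed \<open>y\<close>; the imaginary part becomes \<open>s x' / c + y / c\<close>,
      which is then substituted for fixed \<open>x'\<close>. The Jacobians \<open>1 / |c|\<close> and \<open>|c|\<close> cancel.\<close>
    have "(\<integral>\<^sup>+z. g (u * z) \<partial>lborel)
        = (\<integral>\<^sup>+y. \<integral>\<^sup>+x. g (Complex (-s * y + c * x) (s / c * (-s * y + c * x) + 1 / c * y)) \<partial>lborel \<partial>lborel)"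
    proof (subst nn_integral_lborel_complex(1)[OF m], intro nn_integral_cong arg_cong[where f = g])
      fix x y
      have "s / c * (-s * y + c * x) + 1 / c * y = s * x + (1 - s * s) / c * y"
        using False by (simp add: field_simps)
      also have "1 - s * s = c * c" using 1 by simp
      finally show "u * Complex x y = Complex (-s * y + c * x) (s / c * (-s * y + c * x) + 1 / c * y)"
        using False by (simp add: cs complex_eq_iff)
    qed
    also have "\<dots> = (\<integral>\<^sup>+y. ennreal (1 / \<bar>c\<bar>) * (\<integral>\<^sup>+x. g (Complex x (s / c * x + 1 / c * y)) \<partial>lborel) \<partial>lborel)"
    proof (intro nn_integral_cong)
      fix y
      have "(\<integral>\<^sup>+x. g (Complex x (s / c * x + 1 / c * y)) \<partial>lborel) =
        \<bar>c\<bar> * (\<integral>\<^sup>+x. g (Complex (-s * y + c * x) (s / c * (-s * y + c * x) + 1 / c * y)) \<partial>lborel)"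
        using False by (intro nn_integral_real_affine) auto
      then show "(\<integral>\<^sup>+x. g (Complex (-s * y + c * x) (s / c * (-s * y + c * x) + 1 / c * y)) \<partial>lborel)
         = ennreal (1 / \<bar>c\<bar>) * (\<integral>\<^sup>+x. g (Complex x (s / c * x + 1 / c * y)) \<partial>lborel)"
        using False by (simp add: mult.assoc[symmetric] ennreal_mult'[symmetric])
    qed
    also have "\<dots> = ennreal (1 / \<bar>c\<bar>) * (\<integral>\<^sup>+x. \<integral>\<^sup>+y. g (Complex x (s / c * x + 1 / c * y)) \<partial>lborel \<partial>lborel)"
      by (subst lborel_pair.Fubini') (auto simp: nn_integral_cmult)
    also have "\<dots> = (\<integral>\<^sup>+x. ennreal (1 / \<bar>c\<bar>) * (\<integral>\<^sup>+y. g (Complex x (s / c * x + 1 / c * y)) \<partial>lborel) \<partial>lborel)"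
      by (simp add: nn_integral_cmult)
    also have "\<dots> = (\<integral>\<^sup>+x. \<integral>\<^sup>+y. g (Complex x y) \<partial>lborel \<partial>lborel)"
    proof (intro nn_integral_cong)
      fix x
      have "(\<integral>\<^sup>+y. g (Complex x y) \<partial>lborel) = \<bar>1 / c\<bar> * (\<integral>\<^sup>+y. g (Complex x (s / c * x + 1 / c * y)) \<partial>lborel)"
        using False by (intro nn_integral_real_affine) auto
      then show "ennreal (1 / \<bar>c\<bar>) * (\<integral>\<^sup>+y. g (Complex x (s / c * x + 1 / c * y)) \<partial>lborel) = (\<integral>\<^sup>+y. g (Complex x y) \<partial>lborel)"
        by simp
    qed
    finally show ?thesis by (simp add: nn_integral_lborel_complex(2))
  qed
qed

section \<open>Mean value inequalities for holomorphic functions\<close>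

text \<open>Cauchy's formula at the centre exhibits \<open>F 0\<close> as the mean of
  \<open>F\<close> over the unit circle; the norm then passes inside the integral.\<close>

lemma holomorphic_norm_le_circle_mean:
  assumes F: "F holomorphic_on cball 0 1"
  shows "ennreal (cmod (F 0)) \<le> (\<integral>\<^sup>+t. indicator {0..1} t * ennreal (cmod (F (cis (2 * pi * t)))) \<partial>lborel)"
proof -
  have cf: "continuous_on (cball 0 1) F" using F by (rule holomorphic_on_imp_continuous_on)
  have cont: "continuous_on {0..1} (\<lambda>t::real. F (cis (2 * pi * t)))"
    by (rule continuous_on_compose2[OF cf]) (auto intro!: continuous_intros)
  have "((\<lambda>w. F w / (w - 0)) has_contour_integral 2 * of_real pi * \<i> * F 0) (circlepath 0 1)"
    using F by (intro Cauchy_integral_circlepath_simple) auto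
  then have "((\<lambda>t. (2 * of_real pi * \<i>) * F (cis (2 * pi * t))) has_integral (2 * of_real pi * \<i> * F 0)) {0..1}"
    unfolding has_contour_integral_def
  proof (rule has_integral_eq[rotated])
    fix t :: real assume t: "t \<in> {0..1}"
    have c: "circlepath 0 1 t = cis (2 * pi * t)"
      by (simp add: circlepath cis_conv_exp mult_ac)
    show "F (circlepath 0 1 t) / (circlepath 0 1 t - 0) * vector_derivative (circlepath 0 1) (at t within {0..1})
      = (2 * of_real pi * \<i>) * F (cis (2 * pi * t))"
      using t by (simp add: vector_derivative_circlepath01 c) (simp add: cis_conv_exp field_simps)
  qed
  from has_integral_mult_right[OF this, of "inverse (2 * of_real pi * \<i>)"]
  have "((\<lambda>t. F (cis (2 * pi * t))) has_integral F 0) {0..1}"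
    by (simp add: field_simps)
  then have "F 0 = integral {0..1} (\<lambda>t. F (cis (2 * pi * t)))"
    by (simp add: integral_unique)
  then have "cmod (F 0) \<le> integral {0..1} (\<lambda>t. cmod (F (cis (2 * pi * t))))"
    by simp (intro integral_norm_bound_integral integrable_continuous_real continuous_on_norm cont order_refl)
  moreover have "((\<lambda>t. cmod (F (cis (2 * pi * t)))) has_integral integral {0..1} (\<lambda>t. cmod (F (cis (2 * pi * t))))) {0..1}"
    using cont by (auto intro!: integrable_integral integrable_continuous_real continuous_intros)
  from nn_integral_has_integral_lebesgue[OF _ this]
  have "(\<integral>\<^sup>+t. indicator {0..1} t * ennreal (cmod (F (cis (2 * pi * t)))) \<partial>lborel) = ennreal (integral {0..1} (\<lambda>t. cmod (F (cis (2 * pi * t)))))"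
    by (simp add: ennreal_mult' ennreal_indicator)
  ultimately show ?thesis by (simp add: ennreal_leI)
qed

lemma open_upper_half [simp]: "open upper_half"
  unfolding upper_half_def by (rule open_halfspace_Im_gt)

lemma borel_measurable_indicator_continuous:
  fixes h :: "complex \<Rightarrow> real"
  assumes "continuous_on A h" "A \<in> sets borel"
  shows "(\<lambda>w. indicator A w * ennreal (h w)) \<in> borel_measurable borel"
proof -
  have "(\<lambda>w. indicator A w *\<^sub>R h w) \<in> borel_measurable borel"
    using assms borel_measurable_continuous_on_indicator by blast
  then have "(\<lambda>w. ennreal (indicator A w *\<^sub>R h w)) \<in> borel_measurable borel" by measurable
  also have "(\<lambda>w. ennreal (indicator A w *\<^sub>R h w)) = (\<lambda>w. indicator A w * ennreal (h w))"
    by (auto simp: indicator_def)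
  finally show ?thesis .
qed

text \<open>For each \<open>w\<close> in the disc about 0 the circle mean bounds the centre value of
  \<open>f (z + \<zeta> * w)\<close> as a function of \<open>\<zeta>\<close>. After integration over
  \<open>w\<close> and Tonelli, rotation invariance makes the inner integral independent of the
  angle; this takes the place of polar coordinates.\<close>

lemma norm_times_area_le_disc_integral:
  assumes f: "f holomorphic_on cball z \<rho>" and \<rho>: "0 < \<rho>"
  shows "ennreal (cmod (f z)) * emeasure lborel (ball z \<rho>)
    \<le> (\<integral>\<^sup>+w. indicator (ball z \<rho>) w * ennreal (cmod (f w)) \<partial>lborel)"
proof -
  define H where "H = (\<lambda>w. indicator (ball 0 \<rho>) w * ennreal (cmod (f (z + w))))"
  define G where "G = (\<lambda>w. indicator (ball z \<rho>) w * ennreal (cmod (f w)))"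
  have cf: "continuous_on (cball z \<rho>) f" using f by (rule holomorphic_on_imp_continuous_on)
  have H[measurable]: "H \<in> borel_measurable borel" unfolding H_def
    by (intro borel_measurable_indicator_continuous continuous_on_norm continuous_on_compose2[OF cf])
       (auto intro!: continuous_intros)
  have G[measurable]: "G \<in> borel_measurable borel" unfolding G_def
    by (intro borel_measurable_indicator_continuous continuous_on_norm continuous_on_subset[OF cf]) auto
  have cis[measurable]: "cis \<in> borel_measurable borel"
    by (intro borel_measurable_continuous_onI continuous_intros)
  have "ennreal (cmod (f z)) * emeasure lborel (ball z \<rho>) = (\<integral>\<^sup>+w. ennreal (cmod (f z)) * indicator (ball (0::complex) \<rho>) w \<partial>lborel)"
    using \<rho> by (subst nn_integral_cmult_indicator) (auto simp: emeasure_ball)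
  also have "\<dots> \<le> (\<integral>\<^sup>+w. \<integral>\<^sup>+t. indicator {0..1} t * H (cis (2 * pi * t) * w) \<partial>lborel \<partial>lborel)"
  proof (intro nn_integral_mono)
    fix w :: complex
    show "ennreal (cmod (f z)) * indicator (ball 0 \<rho>) w \<le> (\<integral>\<^sup>+t. indicator {0..1} t * H (cis (2 * pi * t) * w) \<partial>lborel)"
    proof (cases "w \<in> ball 0 \<rho>")
      case True
      have "(\<lambda>\<zeta>. f (z + \<zeta> * w)) holomorphic_on cball 0 1"
      proof (rule holomorphic_on_compose_gen[OF _ f, unfolded o_def])
        show "(\<lambda>\<zeta>. z + \<zeta> * w) ` cball 0 1 \<subseteq> cball z \<rho>"
        proof
          fix x assume "x \<in> (\<lambda>\<zeta>. z + \<zeta> * w) ` cball 0 1"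
          then obtain \<zeta> where "x = z + \<zeta> * w" "\<zeta> \<in> cball 0 1" by blast
          then have "cmod \<zeta> \<le> 1" by simp
          then have "cmod \<zeta> * cmod w \<le> 1 * \<rho>"
            using True by (intro mult_mono) auto
          with \<open>x = z + \<zeta> * w\<close> show "x \<in> cball z \<rho>" by (simp add: dist_norm norm_mult)
        qed
      qed (intro holomorphic_intros)
      from holomorphic_norm_le_circle_mean[OF this] True show ?thesis
        by (simp add: H_def norm_mult)
    qed simp
  qed
  also have "\<dots> = (\<integral>\<^sup>+t. \<integral>\<^sup>+w. indicator {0..1} t * H (cis (2 * pi * t) * w) \<partial>lborel \<partial>lborel)"
    by (rule lborel_pair.Fubini') measurable
  also have "\<dots> = (\<integral>\<^sup>+t. indicator {0..1::real} t * (\<integral>\<^sup>+w. H w \<partial>lborel) \<partial>lborel)"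
    by (intro nn_integral_cong) (simp add: nn_integral_cmult nn_integral_lborel_rotation)
  also have "\<dots> = (\<integral>\<^sup>+w. H w \<partial>lborel)"
    by (simp add: nn_integral_multc)
  also have "\<dots> = (\<integral>\<^sup>+w. G (z + w) \<partial>lborel)"
    by (intro nn_integral_cong) (simp add: H_def G_def indicator_def dist_norm)
  also have "\<dots> = (\<integral>\<^sup>+w. G w \<partial>(distr lborel borel ((+) z)))"
    by (rule nn_integral_distr[symmetric]) auto
  also have "distr lborel borel ((+) z) = lborel"
    by (rule lborel_distr_plus)
  finally show ?thesis by (simp add: G_def)
qed

section \<open>Elementary properties of functions of class U\<close>

lemma class_U_growth: "class_U \<Phi> \<Longrightarrow> growth_function \<Phi>"
  by (auto simp: class_U_def class_U_q_def)

lemma class_U_mono: "class_U \<Phi> \<Longrightarrow> 0 \<le> s \<Longrightarrow> s \<le> t \<Longrightarrow> \<Phi> s \<le> \<Phi> t"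
  by (auto simp: class_U_def class_U_q_def growth_function_def dest: mono_onD)

lemma class_U_nonneg: "class_U \<Phi> \<Longrightarrow> 0 \<le> t \<Longrightarrow> 0 \<le> \<Phi> t"
  using class_U_growth[of \<Phi>] by (auto simp: growth_function_def)

lemma class_U_surj:
  assumes "class_U \<Phi>" "0 \<le> y" obtains t where "0 \<le> t" "\<Phi> t = y"
proof -
  have "y \<in> \<Phi> ` {0..}"
    using class_U_growth[OF assms(1)] assms(2) by (simp add: growth_function_def)
  then show ?thesis using that by auto
qed

lemma class_U_zero: assumes "class_U \<Phi>" shows "\<Phi> 0 = 0"
proof -
  obtain t where "0 \<le> t" "\<Phi> t = 0" using class_U_surj[OF assms, of 0] by auto
  then show ?thesis using class_U_mono[OF assms, of 0 t] class_U_nonneg[OF assms, of 0] by simp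
qed

text \<open>For fixed \<open>t\<close> the power of \<open>t\<close> is absorbed into the constant.
  The maximum with 1 makes it positive, since the definition leaves the sign of its constant
  open.\<close>

lemma class_U_upper_type:
  assumes "class_U \<Phi>" "1 \<le> t"
  obtains C where "0 < C" "\<And>s. 0 < s \<Longrightarrow> \<Phi> (s * t) \<le> C * \<Phi> s"
proof -
  obtain q C where C: "\<And>s t. 0 < s \<Longrightarrow> 1 \<le> t \<Longrightarrow> \<Phi> (s * t) \<le> C * t powr q * \<Phi> s"
    using assms(1) by (auto simp: class_U_def class_U_q_def)
  show ?thesis
  proof
    show "0 < max 1 (C * t powr q)" by simp
    fix s :: real assume "0 < s"
    then have "C * t powr q * \<Phi> s \<le> max 1 (C * t powr q) * \<Phi> s"
      using class_U_nonneg[OF assms(1), of s] by (intro mult_right_mono) auto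
    with C[OF \<open>0 < s\<close> assms(2)] show "\<Phi> (s * t) \<le> max 1 (C * t powr q) * \<Phi> s" by simp
  qed
qed

text \<open>By the upper type bound, a zero at some \<open>t > 0\<close> would spread to all larger
  arguments, against surjectivity.\<close>

lemma class_U_pos: assumes U: "class_U \<Phi>" and "0 < t" shows "0 < \<Phi> t"
proof (rule ccontr)
  assume "\<not> 0 < \<Phi> t"
  then have 0: "\<Phi> t = 0" using class_U_nonneg[OF U, of t] assms by simp
  obtain s where s: "0 \<le> s" "\<Phi> s = 1" using class_U_surj[OF U, of 1] by auto
  \<comment> \<open>At least 1, as the upper type bound demands, and large enough that
    \<open>t * r\<close> reaches the point \<open>s\<close> with value 1.\<close>
  define r where "r = max 1 (s / t)"
  have "1 \<le> r" by (simp add: r_def)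
  then obtain C where C: "\<And>s. 0 < s \<Longrightarrow> \<Phi> (s * r) \<le> C * \<Phi> s"
    by (rule class_U_upper_type[OF U]) blast
  from C[OF \<open>0 < t\<close>] 0 have "\<Phi> (t * r) \<le> 0" by simp
  moreover have "s \<le> t * r" using \<open>0 < t\<close> by (simp add: r_def field_simps max_def)
  then have "\<Phi> s \<le> \<Phi> (t * r)" by (rule class_U_mono[OF U s(1)])
  ultimately show False using s by simp
qed

lemma class_U_ratio_mono:
  assumes "class_U \<Phi>" "0 < s" "s \<le> t" shows "\<Phi> s / s \<le> \<Phi> t / t"
proof -
  have "mono_on {0<..} (\<lambda>t. \<Phi> t / t)" using assms by (auto simp: class_U_def class_U_q_def)
  from mono_onD[OF this, of s t] assms show ?thesis by simp
qed

text \<open>Compares the quotient \<open>\<Phi> t / t\<close> at \<open>c * s\<close> and at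
  \<open>s\<close>. It serves where convexity together with \<open>\<Phi> 0 = 0\<close>
  would.\<close>

lemma class_U_contract:
  assumes U: "class_U \<Phi>" and "0 \<le> s" "0 \<le> c" "c \<le> 1"
  shows "\<Phi> (c * s) \<le> c * \<Phi> s"
proof (cases "c = 0 \<or> s = 0")
  case True
  then show ?thesis using class_U_zero[OF U] by auto
next
  case False
  then have pos: "0 < c" "0 < s" using assms by auto
  have "c * s \<le> s" using pos assms by (simp add: mult_left_le_one_le)
  from class_U_ratio_mono[OF U _ this] pos show ?thesis by (simp add: field_simps)
qed

lemma class_U_strict_mono:
  assumes U: "class_U \<Phi>" and st: "0 \<le> s" "s < t" shows "\<Phi> s < \<Phi> t"
proof (cases "s = 0")
  case True
  then show ?thesis using class_U_pos[OF U, of t] class_U_zero[OF U] st by simp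
next
  case False
  have "\<Phi> s \<le> s / t * \<Phi> t" using class_U_contract[OF U, of t "s / t"] st by simp
  also have "\<dots> < 1 * \<Phi> t" using st class_U_pos[OF U, of t] by (intro mult_strict_right_mono) auto
  finally show ?thesis by simp
qed

text \<open>The definite description denotes: a preimage exists by surjectivity and is unique by
  strict monotonicity.\<close>

lemma growth_inv:
  assumes U: "class_U \<Phi>" and "0 < y"
  shows "0 < growth_inv \<Phi> y" "\<Phi> (growth_inv \<Phi> y) = y"
proof -
  obtain t where t: "0 \<le> t" "\<Phi> t = y" using class_U_surj[OF U, of y] assms by auto
  have "growth_inv \<Phi> y = t" unfolding growth_inv_def
  proof (rule the_equality)
    fix s assume s: "0 \<le> s \<and> \<Phi> s = y"
    show "s = t"
      using class_U_strict_mono[OF U, of s t] class_U_strict_mono[OF U, of t s] s t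
      by (cases s t rule: linorder_cases) auto
  qed (use t in auto)
  moreover have "t \<noteq> 0" using t \<open>0 < y\<close> class_U_zero[OF U] by auto
  ultimately show "0 < growth_inv \<Phi> y" "\<Phi> (growth_inv \<Phi> y) = y" using t by auto
qed

text \<open>Up to \<open>s\<close> the first summand suffices; beyond \<open>s\<close> the monotone
  quotient makes the second one suffice.\<close>

lemma class_U_affine_bound:
  assumes U: "class_U \<Phi>" and "0 < s" "0 \<le> t"
  shows "t \<le> s + s / \<Phi> s * \<Phi> t"
proof (cases "t \<le> s")
  case True
  have "0 \<le> s / \<Phi> s * \<Phi> t" using assms class_U_nonneg[OF U] by simp
  then show ?thesis using True by linarith
next
  case False
  then have "\<Phi> s / s \<le> \<Phi> t / t" using assms by (intro class_U_ratio_mono) auto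
  then have "t \<le> s / \<Phi> s * \<Phi> t" using assms False class_U_pos[OF U, of s] by (simp add: field_simps)
  then show ?thesis using assms by linarith
qed

section \<open>Local estimate by a weighted integral over a disc\<close>

lemma continuous_on_class_U_comp:
  assumes U: "class_U \<Phi>" and f: "continuous_on A f"
  shows "continuous_on A (\<lambda>w. \<Phi> (cmod (f w)))"
  using class_U_growth[OF U] unfolding growth_function_def
  by (auto intro!: continuous_on_compose2[of "{0..}" \<Phi>] continuous_on_norm f)

lemma orlicz_density_measurable:
  assumes U: "class_U \<Phi>" and f: "continuous_on upper_half f"
  shows "(\<lambda>w. indicator upper_half w * ennreal (Im w powr \<alpha>) * ennreal (\<Phi> (cmod (f w)))) \<in> borel_measurable borel"
proof -
  have [measurable]: "(\<lambda>w. indicator upper_half w * ennreal (\<Phi> (cmod (f w)))) \<in> borel_measurable borel"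
    by (intro borel_measurable_indicator_continuous continuous_on_class_U_comp[OF U] f) auto
  have "(\<lambda>w. ennreal (Im w powr \<alpha>) * (indicator upper_half w * ennreal (\<Phi> (cmod (f w))))) \<in> borel_measurable borel"
    by measurable
  then show ?thesis by (simp add: mult_ac)
qed

lemma disc_in_upper_half:
  assumes "0 < Im z" "w \<in> cball z (Im z / 2)"
  shows "Im z / 2 \<le> Im w" "Im w \<le> 3 / 2 * Im z"
  using abs_Im_le_cmod[of "w - z"] assms by (auto simp: dist_norm norm_minus_commute)

text \<open>The power may increase or decrease; the absolute value in the exponent lets one constant
  serve both signs of \<alpha>.\<close>

lemma powr_le_of_comparable:
  fixes u y \<alpha> :: real
  assumes "0 < y" "y / 2 \<le> u" "u \<le> 2 * y"
  shows "y powr \<alpha> \<le> 2 powr \<bar>\<alpha>\<bar> * u powr \<alpha>"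
proof (cases "0 \<le> \<alpha>")
  case True
  have "y powr \<alpha> \<le> (2 * u) powr \<alpha>" using assms True by (intro powr_mono2) auto
  then show ?thesis using True assms by (simp add: powr_mult)
next
  case False
  have "y powr \<alpha> \<le> (u / 2) powr \<alpha>" using assms False by (intro powr_mono2') auto
  then show ?thesis using False assms by (simp add: powr_divide powr_minus field_simps)
qed

text \<open>With \<open>V\<close> the area of the disc, the mean value inequality and the affine
  bound at \<open>s = lam\<close> give
  \<open>2 * lam * V \<le> lam * V + lam / \<Phi> lam * J\<close>. The factor 2 in the hypothesis
  leaves one copy of \<open>lam * V\<close> after cancellation, which is then solved for
  \<open>\<Phi> lam\<close>.\<close>

lemma level_le_disc_integral:
  fixes \<alpha> :: real
  assumes U: "class_U \<Phi>" and f: "f holomorphic_on upper_half"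
    and y: "0 < Im z" and lam: "0 < lam" "2 * lam \<le> cmod (f z)"
  shows "ennreal (\<Phi> lam) \<le> ennreal (2 * 2 powr \<bar>\<alpha>\<bar> * Im z powr (-(2 + \<alpha>))) *
    (\<integral>\<^sup>+w. indicator (ball z (Im z / 2)) w *
      (indicator upper_half w * ennreal (Im w powr \<alpha>) * ennreal (\<Phi> (cmod (f w)))) \<partial>lborel)"
proof -
  define y where "y = Im z"
  define B where "B = ball z (y / 2)"
  have y0: "0 < y" using y by (simp add: y_def)
  have sub: "cball z (y / 2) \<subseteq> upper_half"
    using disc_in_upper_half[OF y] y by (fastforce simp: upper_half_def y_def)
  have cf: "continuous_on upper_half f" using f by (rule holomorphic_on_imp_continuous_on)
  have cB: "continuous_on B f" using sub ball_subset_cball unfolding B_def by (blast intro: continuous_on_subset[OF cf])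
  have pl: "0 < \<Phi> lam" using class_U_pos[OF U] lam by simp
  define V where "V = pi * (y / 2)^2"
  \<comment> \<open>The lower bound uses only that pi exceeds 2; it is the source of the factor 2 in
    the final constant.\<close>
  have V: "emeasure lborel B = ennreal V" "0 < V" "y^2 / 2 \<le> V"
    using y0 pi_gt3 by (auto simp: B_def V_def emeasure_ball unit_ball_vol_2 power2_eq_square)
  define J where "J = (\<integral>\<^sup>+w. indicator B w * ennreal (\<Phi> (cmod (f w))) \<partial>lborel)"
  have mJ[measurable]: "(\<lambda>w. indicator B w * ennreal (\<Phi> (cmod (f w)))) \<in> borel_measurable borel"
    by (intro borel_measurable_indicator_continuous continuous_on_class_U_comp[OF U] cB) (simp add: B_def)
  have [measurable]: "B \<in> sets borel" by (simp add: B_def)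
  have "ennreal (lam * V) + ennreal (lam * V) = ennreal (2 * lam) * ennreal V"
    using lam V by (simp add: ennreal_plus[symmetric] ennreal_mult'[symmetric] del: ennreal_plus)
  also have "\<dots> \<le> ennreal (cmod (f z)) * emeasure lborel B"
    unfolding V using lam by (intro mult_right_mono ennreal_leI) auto
  also have "\<dots> \<le> (\<integral>\<^sup>+w. indicator B w * ennreal (cmod (f w)) \<partial>lborel)"
    unfolding B_def using y0 sub by (intro norm_times_area_le_disc_integral holomorphic_on_subset[OF f]) auto
  also have "\<dots> \<le> (\<integral>\<^sup>+w. ennreal lam * indicator B w + ennreal (lam / \<Phi> lam) * (indicator B w * ennreal (\<Phi> (cmod (f w)))) \<partial>lborel)"
  proof (intro nn_integral_mono)
    fix w
    have "ennreal (cmod (f w)) \<le> ennreal lam + ennreal (lam / \<Phi> lam) * ennreal (\<Phi> (cmod (f w)))"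
      using class_U_affine_bound[OF U lam(1), of "cmod (f w)"] lam pl class_U_nonneg[OF U, of "cmod (f w)"]
      by (simp add: ennreal_plus[symmetric] ennreal_mult'[symmetric] ennreal_leI del: ennreal_plus)
    then show "indicator B w * ennreal (cmod (f w)) \<le> ennreal lam * indicator B w + ennreal (lam / \<Phi> lam) * (indicator B w * ennreal (\<Phi> (cmod (f w))))"
      by (cases "w \<in> B") auto
  qed
  also have "\<dots> = ennreal (lam * V) + ennreal (lam / \<Phi> lam) * J"
    using lam V by (subst nn_integral_add) (auto simp: nn_integral_cmult J_def ennreal_mult')
  finally have "ennreal (lam * V) \<le> ennreal (lam / \<Phi> lam) * J"
    by (simp add: ennreal_add_left_cancel_le)
  then have "ennreal (\<Phi> lam / (lam * V)) * ennreal (lam * V) \<le> ennreal (\<Phi> lam / (lam * V)) * (ennreal (lam / \<Phi> lam) * J)"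
    by (rule mult_left_mono) simp
  then have 1: "ennreal (\<Phi> lam) \<le> ennreal (1 / V) * J"
    using lam V pl by (simp add: ennreal_mult'[symmetric] mult.assoc[symmetric])
  define I where "I = (\<integral>\<^sup>+w. indicator B w *
      (indicator upper_half w * ennreal (Im w powr \<alpha>) * ennreal (\<Phi> (cmod (f w)))) \<partial>lborel)"
  have mI[measurable]: "(\<lambda>w. indicator upper_half w * ennreal (Im w powr \<alpha>) * ennreal (\<Phi> (cmod (f w)))) \<in> borel_measurable borel"
    by (rule orlicz_density_measurable[OF U cf])
  \<comment> \<open>On \<open>B\<close> the imaginary part lies between \<open>y / 2\<close> and
    \<open>3 / 2 * y\<close>, so the weight can be inserted at a bounded cost.\<close>
  have "J \<le> (\<integral>\<^sup>+w. ennreal (2 powr \<bar>\<alpha>\<bar> * y powr (-\<alpha>)) * (indicator B w *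
      (indicator upper_half w * ennreal (Im w powr \<alpha>) * ennreal (\<Phi> (cmod (f w))))) \<partial>lborel)"
    unfolding J_def
  proof (intro nn_integral_mono)
    fix w
    show "indicator B w * ennreal (\<Phi> (cmod (f w))) \<le> ennreal (2 powr \<bar>\<alpha>\<bar> * y powr (-\<alpha>)) * (indicator B w *
      (indicator upper_half w * ennreal (Im w powr \<alpha>) * ennreal (\<Phi> (cmod (f w)))))"
    proof (cases "w \<in> B")
      case True
      then have w: "w \<in> upper_half" "w \<in> cball z (Im z / 2)" using sub by (auto simp: B_def y_def)
      have "y powr \<alpha> \<le> 2 powr \<bar>\<alpha>\<bar> * Im w powr \<alpha>"
        using disc_in_upper_half[OF y w(2)] y0 by (intro powr_le_of_comparable) (auto simp: y_def)
      then have "1 \<le> 2 powr \<bar>\<alpha>\<bar> * y powr (-\<alpha>) * Im w powr \<alpha>"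
        using y0 by (simp add: powr_minus field_simps)
      then have "1 * \<Phi> (cmod (f w)) \<le> 2 powr \<bar>\<alpha>\<bar> * y powr (-\<alpha>) * Im w powr \<alpha> * \<Phi> (cmod (f w))"
        using class_U_nonneg[OF U, of "cmod (f w)"] by (intro mult_right_mono) auto
      then show ?thesis using True w(1) class_U_nonneg[OF U, of "cmod (f w)"]
        by (simp add: ennreal_mult'[symmetric] ennreal_leI mult.assoc)
    qed simp
  qed
  also have "\<dots> = ennreal (2 powr \<bar>\<alpha>\<bar> * y powr (-\<alpha>)) * I"
    unfolding I_def by (rule nn_integral_cmult) measurable
  finally have "ennreal (1 / V) * J \<le> ennreal (1 / V) * (ennreal (2 powr \<bar>\<alpha>\<bar> * y powr (-\<alpha>)) * I)"
    by (rule mult_left_mono) simp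
  also have "\<dots> = ennreal (1 / V * (2 powr \<bar>\<alpha>\<bar> * y powr (-\<alpha>))) * I"
    using V by (subst ennreal_mult') (simp_all add: mult.assoc)
  also have "\<dots> \<le> ennreal (2 * 2 powr \<bar>\<alpha>\<bar> * y powr (-(2 + \<alpha>))) * I"
  proof (intro mult_right_mono ennreal_leI)
    have "1 / V \<le> 2 / y^2" using V y0 by (simp add: field_simps)
    then have "1 / V * (2 powr \<bar>\<alpha>\<bar> * y powr (-\<alpha>)) \<le> 2 / y^2 * (2 powr \<bar>\<alpha>\<bar> * y powr (-\<alpha>))"
      by (intro mult_right_mono) auto
    also have "\<dots> = 2 * 2 powr \<bar>\<alpha>\<bar> * y powr (-(2 + \<alpha>))"
      using y0 powr_diff[of y "-\<alpha>" 2] by (simp add: algebra_simps)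
    finally show "1 / V * (2 powr \<bar>\<alpha>\<bar> * y powr (-\<alpha>)) \<le> 2 * 2 powr \<bar>\<alpha>\<bar> * y powr (-(2 + \<alpha>))" .
  qed simp
  finally show ?thesis using 1 unfolding I_def B_def y_def by simp
qed

section \<open>From the Carleson condition to the weak type estimate\<close>

lemma open_level_set:
  assumes "continuous_on upper_half f"
  shows "open {z\<in>upper_half. c < cmod (f z)}"
proof -
  have "open (upper_half \<inter> (\<lambda>z. cmod (f z)) -` {c<..})"
    by (intro continuous_open_preimage continuous_on_norm assms) auto
  also have "upper_half \<inter> (\<lambda>z. cmod (f z)) -` {c<..} = {z\<in>upper_half. c < cmod (f z)}" by auto
  finally show ?thesis .
qed

text \<open>The normalisation of the integral to at most 1 enters twice: after the exchange of
  integrals, and before it to bound \<open>lam\<close> in terms of the size of the box, so that the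
  monotone ratio can be applied.\<close>

lemma measure_level_set_le:
  fixes \<Phi>1 \<Phi>2 :: "real \<Rightarrow> real" and \<mu> :: "complex measure" and \<alpha> :: real
  assumes U1: "class_U \<Phi>1" and U2: "class_U \<Phi>2"
    and ratio: "mono_on {0<..} (\<lambda>t. \<Phi>2 t / \<Phi>1 t)"
    and sets[measurable_cong]: "sets \<mu> = sets borel"
    and \<alpha>: "\<alpha> > -1" and C: "0 < C"
    and box: "\<And>a b. a < b \<Longrightarrow> emeasure \<mu> (carleson_box a b)
              \<le> ennreal (C / \<Phi>2 (growth_inv \<Phi>1 (1 / (b - a) powr (2 + \<alpha>))))"
    and f: "f holomorphic_on upper_half" and int: "orlicz_int \<Phi>1 \<alpha> f \<le> 1"
    and lam: "0 < lam"
  shows "ennreal (\<Phi>2 (lam / (3 powr (2 + \<alpha>) * (2 * 2 powr \<bar>\<alpha>\<bar>)))) *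
    emeasure \<mu> {z\<in>upper_half. 2 * lam < cmod (f z)} \<le> ennreal C"
proof -
  \<comment> \<open>\<open>K0\<close> is the constant of the disc estimate; \<open>K1\<close> also
    pays for replacing \<open>Im z\<close> by \<open>2 * Im w\<close>, which is less than
    \<open>3 * Im z\<close>.\<close>
  define K0 where "K0 = 2 * 2 powr \<bar>\<alpha>\<bar>"
  define K1 where "K1 = 3 powr (2 + \<alpha>) * K0"
  define E where "E = {z\<in>upper_half. 2 * lam < cmod (f z)}"
  define g where "g = (\<lambda>w. indicator upper_half w * ennreal (Im w powr \<alpha>) * ennreal (\<Phi>1 (cmod (f w))))"
  have K0: "1 \<le> K0" using ge_one_powr_ge_zero[of 2 "\<bar>\<alpha>\<bar>"] by (simp add: K0_def)
  have K1: "1 \<le> K1" "0 < K1"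
    using K0 \<alpha> mult_mono[of 1 "3 powr (2 + \<alpha>)" 1 K0] ge_one_powr_ge_zero[of 3 "2 + \<alpha>"]
    by (auto simp: K1_def)
  have cf: "continuous_on upper_half f" using f by (rule holomorphic_on_imp_continuous_on)
  have g[measurable]: "g \<in> borel_measurable borel"
    unfolding g_def by (rule orlicz_density_measurable[OF U1 cf])
  have gint: "(\<integral>\<^sup>+w. g w \<partial>lborel) \<le> 1" using int by (simp add: g_def orlicz_int_def)
  have "open E" unfolding E_def by (rule open_level_set[OF cf])
  then have E[measurable]: "E \<in> sets borel" by simp
  have EU: "E \<subseteq> upper_half" by (auto simp: E_def)
  have U[measurable]: "upper_half \<in> sets borel" by simp

  \<comment> \<open>Tonelli needs a sigma-finite measure; nothing is assumed about \<open>\<mu>\<close> off the upper half plane.\<close>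
  define N where "N = density \<mu> (indicator upper_half)"
  have setsN[measurable_cong]: "sets N = sets borel" by (simp add: N_def sets)
  have cbox[measurable]: "carleson_box a b \<in> sets borel" for a b
  proof -
    have "carleson_box a b = {z. a \<le> Re z} \<inter> {z. Re z \<le> b} \<inter> {z. 0 < Im z} \<inter> {z. Im z < b - a}"
      by (auto simp: carleson_box_def)
    also have "\<dots> \<in> sets borel"
      by (intro sets.Int borel_closed borel_open closed_halfspace_Re_ge closed_halfspace_Re_le
          open_halfspace_Im_gt open_halfspace_Im_lt)
    finally show ?thesis .
  qed
  have NE: "emeasure N A = emeasure \<mu> (A \<inter> upper_half)" if "A \<in> sets borel" for A
    using that unfolding N_def by (subst emeasure_density) (auto simp: sets indicator_inter_arith[symmetric] Int_commute)
  interpret N: sigma_finite_measure N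
  proof
    \<comment> \<open>The boxes have finite measure by the Carleson condition and exhaust the upper
      half plane; its complement, null for \<open>N\<close>, is added to cover the whole
      plane.\<close>
    let ?A = "\<lambda>n. carleson_box (- real (Suc n)) (real (Suc n)) \<union> (- upper_half)"
    have "emeasure N (?A n) \<noteq> \<infinity>" for n
    proof -
      have "?A n \<inter> upper_half = carleson_box (- real (Suc n)) (real (Suc n))"
        by (auto simp: carleson_box_def upper_half_def)
      moreover have "?A n \<in> sets borel" by measurable
      ultimately have "emeasure N (?A n) = emeasure \<mu> (carleson_box (- real (Suc n)) (real (Suc n)))"
        by (subst NE) auto
      also have "\<dots> < \<infinity>"
        using le_less_trans[OF box[of "- real (Suc n)" "real (Suc n)"] ennreal_less_top] by simp
      finally show ?thesis by simp
    qed
    moreover have "\<Union>(range ?A) = UNIV"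
    proof (intro UNIV_eq_I[symmetric])
      fix z :: complex
      obtain n where "norm z < real n" using reals_Archimedean2 by blast
      then show "z \<in> \<Union>(range ?A)"
        using abs_Re_le_cmod[of z] abs_Im_le_cmod[of z]
        by (auto simp: carleson_box_def upper_half_def intro!: exI[of _ n])
    qed
    ultimately show "\<exists>A. countable A \<and> A \<subseteq> sets N \<and> \<Union>A = space N \<and> (\<forall>a\<in>A. emeasure N a \<noteq> \<infinity>)"
      using sets_eq_imp_space_eq[OF setsN]
      by (intro exI[of _ "range ?A"]) (auto simp: setsN intro!: sets.Un)
  qed
  interpret P: pair_sigma_finite N "lborel :: complex measure" ..

  \<comment> \<open>The disc relation is encoded as one Borel set of pairs, which makes the kernel
    \<open>k\<close> jointly measurable for Tonelli.\<close>
  define D where "D = {p :: complex \<times> complex. dist (fst p) (snd p) < Im (fst p) / 2}"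
  have D[measurable]: "D \<in> sets borel"
    unfolding D_def by (intro borel_open open_Collect_less) (auto intro!: continuous_intros)
  define k where "k = (\<lambda>z w. indicator E z * ennreal (K0 * Im z powr (-(2 + \<alpha>))) * (indicator D (z, w) * g w))"
  have k[measurable]: "(\<lambda>p. k (fst p) (snd p)) \<in> borel_measurable (N \<Otimes>\<^sub>M lborel)"
  proof -
    have "sets (N \<Otimes>\<^sub>M lborel) = sets (borel :: (complex \<times> complex) measure)"
      using sets_pair_measure_cong[OF setsN sets_lborel] by (simp add: borel_prod[symmetric])
    then have [measurable]: "D \<in> sets (N \<Otimes>\<^sub>M lborel)" using D by simp
    show ?thesis unfolding k_def prod.collapse by measurable
  qed
  have level: "ennreal (\<Phi>1 lam) * indicator E z \<le> (\<integral>\<^sup>+w. k z w \<partial>lborel)" for z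
  proof (cases "z \<in> E")
    case True
    then have z: "0 < Im z" "2 * lam \<le> cmod (f z)" by (auto simp: E_def upper_half_def)
    have "ennreal (\<Phi>1 lam) \<le> ennreal (K0 * Im z powr (-(2 + \<alpha>))) *
      (\<integral>\<^sup>+w. indicator (ball z (Im z / 2)) w * g w \<partial>lborel)"
      unfolding K0_def g_def by (rule level_le_disc_integral[OF U1 f z(1) lam z(2)])
    also have "\<dots> = (\<integral>\<^sup>+w. ennreal (K0 * Im z powr (-(2 + \<alpha>))) * (indicator (ball z (Im z / 2)) w * g w) \<partial>lborel)"
      by (intro nn_integral_cmult[symmetric] borel_measurable_times_ennreal borel_measurable_indicator)
         (use g in auto)
    also have "\<dots> = (\<integral>\<^sup>+w. k z w \<partial>lborel)"
      using True by (intro nn_integral_cong) (simp add: k_def D_def indicator_def)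
    finally show ?thesis using True by simp
  qed simp

  \<comment> \<open>The final multiplication by \<open>\<Phi>2 (lam / K1) / \<Phi>1 lam\<close>
    turns \<open>R\<close> into \<open>C\<close>.\<close>
  define R where "R = C * \<Phi>1 lam / \<Phi>2 (lam / K1)"
  have p1: "0 < \<Phi>1 lam" using class_U_pos[OF U1 lam] .
  have p2: "0 < \<Phi>2 (lam / K1)" using class_U_pos[OF U2] lam K1 by simp
  have inner: "(\<integral>\<^sup>+z. k z w \<partial>N) \<le> ennreal R * g w" for w
  proof (cases "\<exists>z\<in>E. (z, w) \<in> D")
    case False
    then have "k z w = 0" for z by (auto simp: k_def indicator_def)
    then show ?thesis by simp
  next
    case True
    define v where "v = Im w"
    \<comment> \<open>For the interval of length \<open>2 * v\<close> about \<open>Re w\<close>,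
      \<open>T\<close> is the reciprocal in the Carleson condition and \<open>s\<close> the argument
      of \<open>\<Phi>2\<close> there.\<close>
    define T where "T = (2 * v) powr (-(2 + \<alpha>))"
    define s where "s = growth_inv \<Phi>1 T"
    \<comment> \<open>Both \<open>\<bar>Im z - v\<bar>\<close> and
      \<open>\<bar>Re z - Re w\<bar>\<close> are below \<open>Im z / 2\<close>, and
      \<open>Im z / 2 < v\<close> follows from the first.\<close>
    have geo: "0 < Im z \<and> Im z < 2 * v \<and> 2 * v < 3 * Im z \<and> \<bar>Re z - Re w\<bar> < v"
      if "z \<in> E" "(z, w) \<in> D" for z
      using that abs_Im_le_cmod[of "z - w"] abs_Re_le_cmod[of "z - w"]
      by (auto simp: E_def upper_half_def D_def dist_norm v_def)
    obtain z0 where z0: "z0 \<in> E" "(z0, w) \<in> D" using True by auto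
    have v: "0 < v" using geo[OF z0] by linarith
    have T: "0 < T" using v by (simp add: T_def)
    have pw: "u powr (-(2 + \<alpha>)) \<le> 3 powr (2 + \<alpha>) * T" if "2 * v \<le> 3 * u" for u
    proof -
      have "(3 * u) powr (-(2 + \<alpha>)) \<le> T"
        unfolding T_def using that \<alpha> v by (intro powr_mono2') auto
      then have "3 powr (2 + \<alpha>) * (3 * u) powr (-(2 + \<alpha>)) \<le> 3 powr (2 + \<alpha>) * T"
        by (rule mult_left_mono) simp
      also have "3 powr (2 + \<alpha>) * (3 * u) powr (-(2 + \<alpha>)) = u powr (-(2 + \<alpha>))"
        using that v by (simp add: powr_mult mult.assoc[symmetric] powr_add[symmetric])
      finally show ?thesis .
    qed
    have s: "0 < s" "\<Phi>1 s = T" using growth_inv[OF U1 T] by (auto simp: s_def)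
    \<comment> \<open>One point \<open>z0\<close> of the level set near \<open>w\<close> suffices:
      enlarging its disc to the half plane, where the integral is at most 1, bounds
      \<open>lam\<close> at this scale.\<close>
    have "ennreal (\<Phi>1 lam) \<le> (\<integral>\<^sup>+w. k z0 w \<partial>lborel)"
      using level[of z0] z0 by simp
    also have "\<dots> \<le> (\<integral>\<^sup>+w. ennreal (K0 * Im z0 powr (-(2 + \<alpha>))) * g w \<partial>lborel)"
      using z0 by (intro nn_integral_mono) (auto simp: k_def indicator_def)
    also have "\<dots> = ennreal (K0 * Im z0 powr (-(2 + \<alpha>))) * (\<integral>\<^sup>+w. g w \<partial>lborel)"
      by (rule nn_integral_cmult) measurable
    also have "\<dots> \<le> ennreal (K0 * Im z0 powr (-(2 + \<alpha>))) * 1"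
      by (intro mult_left_mono gint) auto
    finally have "\<Phi>1 lam \<le> K0 * Im z0 powr (-(2 + \<alpha>))"
      using K0 by (simp add: ennreal_le_iff)
    also have "\<dots> \<le> K0 * (3 powr (2 + \<alpha>) * T)"
      using pw[of "Im z0"] geo[OF z0] K0 by (intro mult_left_mono) auto
    finally have lamT: "\<Phi>1 lam \<le> K1 * T" by (simp add: K1_def mult_ac)
    \<comment> \<open>Contraction moves \<open>K1\<close> inside \<open>\<Phi>1\<close>. This yields
      \<open>lam / K1 \<le> s\<close>, and the ratio hypothesis compares these two points.\<close>
    have "\<Phi>1 (lam / K1) \<le> \<Phi>1 lam / K1"
      using class_U_contract[OF U1, of lam "1 / K1"] lam K1 by simp
    also have "\<dots> \<le> \<Phi>1 s" using lamT K1 s by (simp add: field_simps)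
    finally have le: "\<Phi>1 (lam / K1) \<le> \<Phi>1 s" .
    then have "lam / K1 \<le> s"
      using class_U_strict_mono[OF U1, of s "lam / K1"] s by force
    then have "\<Phi>2 (lam / K1) / \<Phi>1 (lam / K1) \<le> \<Phi>2 s / \<Phi>1 s"
      using mono_onD[OF ratio, of "lam / K1" s] lam K1 s by simp
    then have "\<Phi>1 s / \<Phi>2 s \<le> \<Phi>1 (lam / K1) / \<Phi>2 (lam / K1)"
      using p2 s class_U_pos[OF U1, of "lam / K1"] class_U_pos[OF U1, of s] class_U_pos[OF U2, of s] lam K1
      by (simp add: field_simps)
    also have "\<dots> \<le> (\<Phi>1 lam / K1) / \<Phi>2 (lam / K1)"
      using \<open>\<Phi>1 (lam / K1) \<le> \<Phi>1 lam / K1\<close> p2 by (intro divide_right_mono) auto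
    finally have "K1 * C * (T / \<Phi>2 s) \<le> K1 * C * ((\<Phi>1 lam / K1) / \<Phi>2 (lam / K1))"
      using K1 C s by (intro mult_left_mono) auto
    then have bound: "K1 * T * (C / \<Phi>2 s) \<le> R"
      using K1 by (simp add: R_def mult_ac)
    have inv: "1 / (2 * v) powr (2 + \<alpha>) = T" unfolding T_def powr_minus_divide ..
    let ?Q = "carleson_box (Re w - v) (Re w + v)"
    have kle: "k z w \<le> ennreal (K1 * T) * g w * indicator (?Q \<inter> upper_half) z" for z
    proof (cases "z \<in> E \<and> (z, w) \<in> D")
      case z: True
      have "K0 * Im z powr (-(2 + \<alpha>)) \<le> K1 * T"
        using mult_left_mono[OF pw[of "Im z"], of K0] geo[of z] z K0 by (simp add: K1_def mult_ac)
      moreover have "z \<in> ?Q \<inter> upper_half"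
        using geo[of z] z by (auto simp: carleson_box_def upper_half_def)
      ultimately show ?thesis using z
        by (auto simp: k_def intro!: mult_right_mono ennreal_leI)
    next
      case False
      then show ?thesis by (auto simp: k_def)
    qed
    have "(\<integral>\<^sup>+z. k z w \<partial>N) \<le> (\<integral>\<^sup>+z. ennreal (K1 * T) * g w * indicator (?Q \<inter> upper_half) z \<partial>N)"
      by (intro nn_integral_mono kle)
    also have "\<dots> = ennreal (K1 * T) * g w * emeasure N (?Q \<inter> upper_half)"
      by (rule nn_integral_cmult_indicator) measurable
    also have "emeasure N (?Q \<inter> upper_half) = emeasure \<mu> ?Q"
      by (subst NE) (auto simp: carleson_box_def upper_half_def intro!: arg_cong[where f = "emeasure \<mu>"] sets.Int)
    also have "ennreal (K1 * T) * g w * emeasure \<mu> ?Q \<le> ennreal (K1 * T) * g w * ennreal (C / \<Phi>2 s)"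
      using box[of "Re w - v" "Re w + v"] v by (intro mult_left_mono) (auto simp: s_def inv)
    also have "\<dots> = ennreal (K1 * T * (C / \<Phi>2 s)) * g w"
      using K1 T by (subst ennreal_mult') (simp_all add: mult_ac)
    also have "\<dots> \<le> ennreal R * g w"
      by (intro mult_right_mono ennreal_leI bound) auto
    finally show ?thesis .
  qed

  have "ennreal (\<Phi>1 lam) * emeasure \<mu> E = ennreal (\<Phi>1 lam) * emeasure N E"
    using EU by (subst NE) (auto simp: Int_absorb2)
  also have "\<dots> = (\<integral>\<^sup>+z. ennreal (\<Phi>1 lam) * indicator E z \<partial>N)"
    by (rule nn_integral_cmult_indicator[symmetric]) measurable
  also have "\<dots> \<le> (\<integral>\<^sup>+z. \<integral>\<^sup>+w. k z w \<partial>lborel \<partial>N)"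
    by (intro nn_integral_mono level)
  also have "\<dots> = (\<integral>\<^sup>+w. \<integral>\<^sup>+z. k z w \<partial>N \<partial>lborel)"
    using k by (intro P.Fubini'[symmetric]) (simp add: case_prod_beta')
  also have "\<dots> \<le> (\<integral>\<^sup>+w. ennreal R * g w \<partial>lborel)"
    by (intro nn_integral_mono inner)
  also have "\<dots> = ennreal R * (\<integral>\<^sup>+w. g w \<partial>lborel)"
    by (rule nn_integral_cmult) measurable
  also have "\<dots> \<le> ennreal R * 1"
    by (intro mult_left_mono gint) auto
  finally have "ennreal (\<Phi>2 (lam / K1) / \<Phi>1 lam) * (ennreal (\<Phi>1 lam) * emeasure \<mu> E) \<le> ennreal (\<Phi>2 (lam / K1) / \<Phi>1 lam) * ennreal R"
    by (intro mult_left_mono) auto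
  then show ?thesis
    using p1 p2 C by (simp add: mult.assoc[symmetric] ennreal_mult'[symmetric] R_def K1_def K0_def E_def)
qed

section \<open>Scaling of the Orlicz integral and the Luxemburg norm\<close>

lemma orlicz_int_divide_le:
  assumes U: "class_U \<Phi>" and f: "continuous_on upper_half f" and r: "1 \<le> r"
  shows "orlicz_int \<Phi> \<alpha> (\<lambda>z. f z / complex_of_real r) \<le> ennreal (1 / r) * orlicz_int \<Phi> \<alpha> f"
proof -
  have "orlicz_int \<Phi> \<alpha> (\<lambda>z. f z / complex_of_real r)
    \<le> (\<integral>\<^sup>+z. ennreal (1 / r) * (indicator upper_half z * ennreal (Im z powr \<alpha>) * ennreal (\<Phi> (cmod (f z)))) \<partial>lborel)"
    unfolding orlicz_int_def
  proof (intro nn_integral_mono)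
    fix z
    have "\<Phi> (cmod (f z / complex_of_real r)) \<le> 1 / r * \<Phi> (cmod (f z))"
      using class_U_contract[OF U, of "cmod (f z)" "1 / r"] r by (simp add: norm_divide)
    then have "ennreal (\<Phi> (cmod (f z / complex_of_real r))) \<le> ennreal (1 / r) * ennreal (\<Phi> (cmod (f z)))"
      using r by (subst ennreal_mult'[symmetric]) (auto intro: ennreal_leI)
    then show "indicator upper_half z * ennreal (Im z powr \<alpha>) * ennreal (\<Phi> (cmod (f z / complex_of_real r)))
      \<le> ennreal (1 / r) * (indicator upper_half z * ennreal (Im z powr \<alpha>) * ennreal (\<Phi> (cmod (f z))))"
      by (auto simp: indicator_def mult.left_commute[of "ennreal (1 / r)"] intro!: mult_left_mono)
  qed
  also have "\<dots> = ennreal (1 / r) * orlicz_int \<Phi> \<alpha> f"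
    unfolding orlicz_int_def
    by (intro nn_integral_cmult) (use orlicz_density_measurable[OF U f] in simp)
  finally show ?thesis .
qed

lemma lux_norm_le:
  assumes "0 < r" "orlicz_int \<Phi> \<alpha> (\<lambda>z. f z / complex_of_real r) \<le> 1"
  shows "lux_norm \<Phi> \<alpha> f \<le> r"
  unfolding lux_norm_def using assms by (intro cInf_lower bdd_belowI[of _ 0]) auto

text \<open>Admissible radii are closed under enlargement, and finiteness of the integral provides
  at least one. Every radius strictly above the infimum is therefore admissible.\<close>

lemma orlicz_int_divide_le_one:
  assumes U: "class_U \<Phi>" and f: "f \<in> bergman_orlicz \<Phi> \<alpha>" and r: "lux_norm \<Phi> \<alpha> f < r"
  shows "0 < r" "orlicz_int \<Phi> \<alpha> (\<lambda>z. f z / complex_of_real r) \<le> 1"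
proof -
  define S where "S = {r. r > 0 \<and> orlicz_int \<Phi> \<alpha> (\<lambda>z. f z / complex_of_real r) \<le> 1}"
  have cf: "continuous_on upper_half f" and fin: "orlicz_int \<Phi> \<alpha> f < \<infinity>"
    using f by (auto simp: bergman_orlicz_def holomorphic_on_imp_continuous_on)
  obtain c where c: "orlicz_int \<Phi> \<alpha> f = ennreal c" "0 \<le> c"
    using fin by (cases "orlicz_int \<Phi> \<alpha> f") auto
  \<comment> \<open>Division by a radius at least 1 shrinks the integral by at least that factor, so
    a radius that is also at least \<open>c\<close> is admissible.\<close>
  have "max 1 c \<in> S"
  proof -
    have "orlicz_int \<Phi> \<alpha> (\<lambda>z. f z / complex_of_real (max 1 c)) \<le> ennreal (1 / max 1 c) * ennreal c"
      using orlicz_int_divide_le[OF U cf, of "max 1 c" \<alpha>] c by simp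
    also have "\<dots> \<le> 1"
      using c by (subst ennreal_mult'[symmetric]) (auto simp: ennreal_le_1 divide_le_eq_1)
    finally show ?thesis by (simp add: S_def)
  qed
  then have "\<exists>r'\<in>S. r' < r"
    using r cInf_lessD[of S r] unfolding lux_norm_def S_def by auto
  then obtain r' where r': "0 < r'" "r' < r" "orlicz_int \<Phi> \<alpha> (\<lambda>z. f z / complex_of_real r') \<le> 1"
    by (auto simp: S_def)
  show "0 < r" using r' by simp
  have "orlicz_int \<Phi> \<alpha> (\<lambda>z. f z / complex_of_real r) \<le> orlicz_int \<Phi> \<alpha> (\<lambda>z. f z / complex_of_real r')"
    unfolding orlicz_int_def using r'
    by (intro nn_integral_mono mult_left_mono ennreal_leI class_U_mono[OF U])
       (auto simp: norm_divide intro!: divide_left_mono)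
  with r' show "orlicz_int \<Phi> \<alpha> (\<lambda>z. f z / complex_of_real r) \<le> 1" by simp
qed

section \<open>Integrals of the test functions\<close>

text \<open>The arctangent handles the right half-line and reflection the left one; the half-lines
  share 0, hence an inequality.\<close>

lemma nn_integral_inverse_one_plus_square:
  "(\<integral>\<^sup>+x. ennreal (1 / (1 + x^2)) \<partial>lborel) \<le> ennreal pi"
proof -
  have half: "(\<integral>\<^sup>+x. ennreal (1 / (1 + x^2)) * indicator {0..} x \<partial>lborel) = ennreal (pi / 2 - arctan 0)"
  proof (rule nn_integral_FTC_atLeast)
    show "(arctan has_real_derivative 1 / (1 + x\<^sup>2)) (at x)" for x
      using DERIV_arctan[of x] by (simp add: inverse_eq_divide)
    show "(arctan \<longlongrightarrow> pi / 2) at_top" by (rule tendsto_arctan_at_top)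
  qed (auto intro!: borel_measurable_continuous_onI continuous_intros simp: add_nonneg_eq_0_iff)
  have "(\<integral>\<^sup>+x. ennreal (1 / (1 + x^2)) * indicator {..0} x \<partial>lborel)
    = (\<integral>\<^sup>+x. ennreal (1 / (1 + x^2)) * indicator {0..} x \<partial>lborel)"
    by (subst nn_integral_real_affine[where c = "-1" and t = 0])
       (auto intro!: nn_integral_cong simp: indicator_def)
  then have other: "(\<integral>\<^sup>+x. ennreal (1 / (1 + x^2)) * indicator {..0} x \<partial>lborel) = ennreal (pi / 2)"
    using half by simp
  have "(\<integral>\<^sup>+x. ennreal (1 / (1 + x^2)) \<partial>lborel)
    \<le> (\<integral>\<^sup>+x. ennreal (1 / (1 + x^2)) * indicator {0..} x + ennreal (1 / (1 + x^2)) * indicator {..0} x \<partial>lborel)"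
    by (intro nn_integral_mono) (auto simp: indicator_def)
  also have "\<dots> = ennreal (pi / 2) + ennreal (pi / 2)"
    by (subst nn_integral_add) (use half other in auto)
  also have "\<dots> = ennreal pi" by (simp add: ennreal_plus[symmetric] del: ennreal_plus)
  finally show ?thesis .
qed

lemma nn_integral_cauchy_kernel:
  assumes h: "0 < (h::real)"
  shows "(\<integral>\<^sup>+x. ennreal (h^2 / ((x - x0)^2 + h^2)) \<partial>lborel) \<le> ennreal (pi * h)"
proof -
  have "(\<integral>\<^sup>+x. ennreal (h^2 / ((x - x0)^2 + h^2)) \<partial>lborel)
    = ennreal h * (\<integral>\<^sup>+x. ennreal (1 / (1 + x^2)) \<partial>lborel)"
  proof (subst nn_integral_real_affine[where c = h and t = x0])
    have "h\<^sup>2 / ((x0 + h * x - x0)\<^sup>2 + h\<^sup>2) = 1 / (1 + x\<^sup>2)" for x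
    proof -
      have "(x0 + h * x - x0)\<^sup>2 + h\<^sup>2 = h\<^sup>2 * (1 + x\<^sup>2)" by (simp add: algebra_simps)
      then show ?thesis using h by simp
    qed
    then show "ennreal \<bar>h\<bar> * (\<integral>\<^sup>+x. ennreal (h\<^sup>2 / ((x0 + h * x - x0)\<^sup>2 + h\<^sup>2)) \<partial>lborel)
      = ennreal h * (\<integral>\<^sup>+x. ennreal (1 / (1 + x^2)) \<partial>lborel)"
      using h by simp
  qed (use h in auto)
  also have "\<dots> \<le> ennreal h * ennreal pi"
    by (intro mult_left_mono nn_integral_inverse_one_plus_square) auto
  finally show ?thesis using h by (simp add: ennreal_mult'[symmetric] mult.commute)
qed

text \<open>The power is split into a square, dominated by a Cauchy kernel in the horizontal
  variable, and an \<open>n\<close>-th power for the vertical one. Convergence near 0 comes from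
  \<open>-1 < \<alpha>\<close>, at infinity from \<open>\<alpha> + 1 < n\<close>.\<close>

lemma test_function_integral:
  fixes \<alpha> h x0 :: real and n :: nat
  assumes \<alpha>: "-1 < \<alpha>" and n: "\<alpha> + 1 < n" and h: "0 < h"
  shows "(\<integral>\<^sup>+z. indicator upper_half z * ennreal (Im z powr \<alpha>) *
      ennreal ((h / cmod (z - Complex x0 (-h))) ^ (n + 2)) \<partial>lborel)
    \<le> ennreal (pi * (1 / (\<alpha> + 1) + 1 / (n - \<alpha> - 1)) * h powr (2 + \<alpha>))"
proof -
  define X where "X = (\<lambda>x. ennreal (h^2 / ((x - x0)^2 + h^2)))"
  \<comment> \<open>The distance to the pole is at least \<open>y + h\<close>, so the
    \<open>n\<close>-th power is at most 1, used up to height \<open>h\<close>, and at most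
    \<open>(h / y) ^ n\<close>, used above it.\<close>
  define Y where "Y = (\<lambda>y. indicator {0..h} y * ennreal (y powr \<alpha>) + ennreal (h ^ n) * (indicator {h..} y * ennreal (y powr (\<alpha> - n))))"
  have [measurable]: "X \<in> borel_measurable borel" "Y \<in> borel_measurable borel"
    unfolding X_def Y_def by measurable
  have "(\<integral>\<^sup>+z. indicator upper_half z * ennreal (Im z powr \<alpha>) *
      ennreal ((h / cmod (z - Complex x0 (-h))) ^ (n + 2)) \<partial>lborel)
    \<le> (\<integral>\<^sup>+z. X (Re z) * Y (Im z) \<partial>lborel)"
  proof (intro nn_integral_mono)
    fix z
    show "indicator upper_half z * ennreal (Im z powr \<alpha>) * ennreal ((h / cmod (z - Complex x0 (-h))) ^ (n + 2)) \<le> X (Re z) * Y (Im z)"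
    proof (cases "z \<in> upper_half")
      case True
      define y where "y = Im z"
      define d where "d = cmod (z - Complex x0 (-h))"
      have y: "0 < y" using True by (simp add: upper_half_def y_def)
      have d2: "d^2 = (Re z - x0)^2 + (y + h)^2" by (simp add: d_def cmod_power2 y_def)
      have dy: "y + h \<le> d" using abs_Im_le_cmod[of "z - Complex x0 (-h)"] y h by (simp add: d_def y_def)
      have d: "0 < d" using dy y h by linarith
      have "h^2 \<le> (y + h)^2" using y h by (intro power_mono) auto
      then have 1: "(h / d)^2 \<le> h^2 / ((Re z - x0)^2 + h^2)"
        unfolding power_divide d2 using h by (intro divide_left_mono) (auto intro!: mult_pos_pos add_nonneg_pos)
      have 2: "ennreal (y powr \<alpha>) * ennreal ((h / d)^n) \<le> Y y"
      proof (cases "y \<le> h")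
        case True
        have "(h / d)^n \<le> 1" using dy y h d by (intro power_le_one) auto
        then have "y powr \<alpha> * (h / d)^n \<le> y powr \<alpha>" by (simp add: mult_left_le)
        then have "ennreal (y powr \<alpha>) * ennreal ((h / d)^n) \<le> ennreal (y powr \<alpha>)"
          using d h by (subst ennreal_mult'[symmetric]) (auto intro: ennreal_leI)
        also have "\<dots> \<le> Y y" using True y by (simp add: Y_def)
        finally show ?thesis .
      next
        case False
        have "(h / d)^n \<le> (h / y)^n" using dy y h d by (intro power_mono divide_left_mono) auto
        then have "y powr \<alpha> * (h / d)^n \<le> y powr \<alpha> * (h / y)^n" by (intro mult_left_mono) auto
        also have "\<dots> = h ^ n * y powr (\<alpha> - n)"
          using y by (simp add: powr_diff powr_realpow power_divide)
        finally have "ennreal (y powr \<alpha>) * ennreal ((h / d)^n) \<le> ennreal (h ^ n) * ennreal (y powr (\<alpha> - n))"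
          using h d by (simp add: ennreal_mult'[symmetric] ennreal_leI)
        also have "\<dots> \<le> Y y" using False by (simp add: Y_def)
        finally show ?thesis .
      qed
      have "ennreal (y powr \<alpha>) * ennreal ((h / d) ^ (n + 2)) = ennreal ((h / d)^2) * (ennreal (y powr \<alpha>) * ennreal ((h / d)^n))"
      proof -
        have "ennreal ((h / d) ^ (n + 2)) = ennreal ((h / d)^2) * ennreal ((h / d)^n)"
          using h d by (simp only: power_add mult.commute ennreal_mult' zero_le_power zero_le_divide_iff less_imp_le simp_thms)
        then show ?thesis by (simp only: mult_ac)
      qed
      also have "\<dots> \<le> X (Re z) * Y y"
        unfolding X_def using 1 2 by (intro mult_mono ennreal_leI) auto
      finally show ?thesis using True by (simp add: d_def y_def)
    qed simp
  qed
  also have "\<dots> = (\<integral>\<^sup>+y. \<integral>\<^sup>+x. X x * Y y \<partial>lborel \<partial>lborel)"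
    by (subst nn_integral_lborel_complex(1)) auto
  also have "\<dots> = (\<integral>\<^sup>+x. X x \<partial>lborel) * (\<integral>\<^sup>+y. Y y \<partial>lborel)"
    by (simp add: nn_integral_multc nn_integral_cmult)
  also have "\<dots> \<le> ennreal (pi * h) * (\<integral>\<^sup>+y. Y y \<partial>lborel)"
    unfolding X_def by (intro mult_right_mono nn_integral_cauchy_kernel h) auto
  also have "(\<integral>\<^sup>+y. Y y \<partial>lborel) = (\<integral>\<^sup>+y. indicator {0..h} y * ennreal (y powr \<alpha>) \<partial>lborel)
      + ennreal (h ^ n) * (\<integral>\<^sup>+y. indicator {h..} y * ennreal (y powr (\<alpha> - n)) \<partial>lborel)"
    unfolding Y_def by (subst nn_integral_add) (auto simp: nn_integral_cmult)
  also have "(\<integral>\<^sup>+y. indicator {0..h} y * ennreal (y powr \<alpha>) \<partial>lborel) = ennreal (h powr (\<alpha> + 1) / (\<alpha> + 1))"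
    using nn_integral_has_integral_lebesgue[OF _ has_integral_powr_from_0[OF \<alpha>, of h]] h
    by (simp add: ennreal_mult' ennreal_indicator)
  also have "(\<integral>\<^sup>+y. indicator {h..} y * ennreal (y powr (\<alpha> - n)) \<partial>lborel) = ennreal (- (h powr (\<alpha> - n + 1)) / (\<alpha> - n + 1))"
    using nn_integral_has_integral_lebesgue[OF _ has_integral_powr_to_inf[of "\<alpha> - n" h]] h n
    by (simp add: ennreal_mult' ennreal_indicator)
  also have "ennreal (pi * h) * (ennreal (h powr (\<alpha> + 1) / (\<alpha> + 1)) + ennreal (h ^ n) * ennreal (- (h powr (\<alpha> - n + 1)) / (\<alpha> - n + 1)))
    = ennreal (pi * (1 / (\<alpha> + 1) + 1 / (n - \<alpha> - 1)) * h powr (2 + \<alpha>))"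
  proof -
    have "h ^ n * (- (h powr (\<alpha> - n + 1)) / (\<alpha> - n + 1)) = h powr (\<alpha> + 1) * (1 / (n - \<alpha> - 1))"
    proof -
      have "h ^ n * h powr (\<alpha> - n + 1) = h powr (\<alpha> + 1)"
        using h by (simp add: powr_realpow[symmetric] powr_add[symmetric])
      moreover have "- (h powr (\<alpha> - n + 1)) / (\<alpha> - n + 1) = h powr (\<alpha> - n + 1) / (n - \<alpha> - 1)"
        using n by (simp add: field_simps)
      ultimately show ?thesis by simp
    qed
    moreover have "h * h powr (\<alpha> + 1) = h powr (2 + \<alpha>)"
      using h powr_mult_base[of h "\<alpha> + 1"] by (simp add: algebra_simps)
    moreover have "0 \<le> - (h powr (\<alpha> - n + 1)) / (\<alpha> - n + 1)"
      using n by (simp add: divide_nonneg_neg)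
    ultimately show ?thesis
      using h \<alpha> n by (simp add: ennreal_mult'[symmetric] ennreal_plus[symmetric] algebra_simps del: ennreal_plus)
  qed
  finally show ?thesis .
qed

section \<open>Equivalence of the Carleson condition and the weak type bound\<close>

theorem theorem7p2:
  fixes \<Phi>1 \<Phi>2 :: "real \<Rightarrow> real" and \<mu> :: "complex measure" and \<alpha> :: real
  assumes "class_U \<Phi>1" and "class_U \<Phi>2"
    and "nabla2 \<Phi>1"
    and "mono_on {0<..} (\<lambda>t. \<Phi>2 t / \<Phi>1 t)"
    and "sets \<mu> = sets borel"
    and "\<alpha> > -1"
  shows "(\<exists>C1>0. \<forall>a b. a < b \<longrightarrow>
            emeasure \<mu> (carleson_box a b)
              \<le> ennreal (C1 / \<Phi>2 (growth_inv \<Phi>1 (1 / (b - a) powr (2 + \<alpha>)))))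
    \<longleftrightarrow>
         (\<exists>C2>0. \<forall>f\<in>bergman_orlicz \<Phi>1 \<alpha>. (\<exists>z\<in>upper_half. f z \<noteq> 0) \<longrightarrow>
            (\<forall>lam>0. ennreal (\<Phi>2 lam) *
               emeasure \<mu> {z\<in>upper_half. cmod (f z) > C2 * lam * lux_norm \<Phi>1 \<alpha> f} \<le> 1))"
    (is "?A \<longleftrightarrow> ?B")
proof
  note U1 = assms(1) and U2 = assms(2) and \<mu> = assms(5) and \<alpha> = assms(6)
  show ?B if ?A
  proof -
    from that obtain C where C: "0 < C" and box: "\<And>a b. a < b \<Longrightarrow> emeasure \<mu> (carleson_box a b)
              \<le> ennreal (C / \<Phi>2 (growth_inv \<Phi>1 (1 / (b - a) powr (2 + \<alpha>))))"
      by blast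
    \<comment> \<open>\<open>K\<close> is the constant of \<open>measure_level_set_le\<close>. The
      factor \<open>D\<close> is put into the argument of \<open>\<Phi>2\<close>, where contraction
      by \<open>1 / D\<close> turns the bound \<open>C\<close> into 1.\<close>
    define K where "K = 3 powr (2 + \<alpha>) * (2 * 2 powr \<bar>\<alpha>\<bar>)"
    define D where "D = max 1 C"
    have K: "0 < K" by (simp add: K_def)
    have D: "1 \<le> D" "C \<le> D" by (auto simp: D_def)
    have main: "ennreal (\<Phi>2 lam) * emeasure \<mu> {z\<in>upper_half. 2 * K * D * lam * r < cmod (f z)} \<le> 1"
      if f: "f \<in> bergman_orlicz \<Phi>1 \<alpha>" and r: "lux_norm \<Phi>1 \<alpha> f < r" and lam: "0 < lam" for f r lam
    proof -
      have r0: "0 < r" and int: "orlicz_int \<Phi>1 \<alpha> (\<lambda>z. f z / complex_of_real r) \<le> 1"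
        using orlicz_int_divide_le_one[OF U1 f r] by auto
      have hol: "(\<lambda>z. f z / complex_of_real r) holomorphic_on upper_half"
        using f r0 by (auto simp: bergman_orlicz_def intro!: holomorphic_intros)
      have l: "0 < K * D * lam" using K D lam by simp
      have "ennreal (\<Phi>2 (D * lam)) * emeasure \<mu> {z\<in>upper_half. 2 * (K * D * lam) < cmod (f z / complex_of_real r)} \<le> ennreal C"
        using measure_level_set_le[OF U1 U2 assms(4) \<mu> \<alpha> C box hol int l] K
        by (simp add: K_def[symmetric])
      also have "{z\<in>upper_half. 2 * (K * D * lam) < cmod (f z / complex_of_real r)} = {z\<in>upper_half. 2 * K * D * lam * r < cmod (f z)}"
        using r0 by (auto simp: norm_divide field_simps)
      finally have "ennreal (\<Phi>2 (D * lam)) * emeasure \<mu> {z\<in>upper_half. 2 * K * D * lam * r < cmod (f z)} \<le> ennreal C" .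
      then have "ennreal (1 / D) * (ennreal (\<Phi>2 (D * lam)) * emeasure \<mu> {z\<in>upper_half. 2 * K * D * lam * r < cmod (f z)}) \<le> ennreal (1 / D) * ennreal C"
        by (rule mult_left_mono) simp
      also have "\<dots> \<le> 1" using D C by (subst ennreal_mult'[symmetric]) (auto simp: ennreal_le_1)
      finally have "ennreal (1 / D * \<Phi>2 (D * lam)) * emeasure \<mu> {z\<in>upper_half. 2 * K * D * lam * r < cmod (f z)} \<le> 1"
        using D by (subst ennreal_mult') (simp_all only: mult.assoc, simp)
      moreover have "\<Phi>2 lam \<le> 1 / D * \<Phi>2 (D * lam)"
        using class_U_contract[OF U2, of "D * lam" "1 / D"] D lam by simp
      ultimately show ?thesis
        by (meson ennreal_leI mult_right_mono order_trans zero_le)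
    qed
    show ?B
    proof (intro exI[of _ "2 * K * D"] conjI ballI impI allI)
      show "0 < 2 * K * D" using K D by simp
      fix f and lam :: real assume f: "f \<in> bergman_orlicz \<Phi>1 \<alpha>" and lam: "0 < lam"
      \<comment> \<open>The infimum defining the norm is approached from above and the level sets increase accordingly, so neither
        positivity of the norm nor attainment of the infimum is needed.\<close>
      define L where "L = lux_norm \<Phi>1 \<alpha> f"
      define A where "A = (\<lambda>n::nat. {z\<in>upper_half. 2 * K * D * lam * (L + 1 / Suc n) < cmod (f z)})"
      have cf: "continuous_on upper_half f"
        using f by (auto simp: bergman_orlicz_def holomorphic_on_imp_continuous_on)
      have c0: "0 < 2 * K * D * lam" using K D lam by simp
      have A: "range A \<subseteq> sets \<mu>"
      proof (rule image_subsetI)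
        show "A n \<in> sets \<mu>" for n unfolding A_def \<mu> by (intro borel_open open_level_set cf)
      qed
      have inc: "incseq A"
      proof (intro incseq_SucI subsetI)
        fix n z assume "z \<in> A n"
        moreover have "1 / real (Suc (Suc n)) \<le> 1 / real (Suc n)" by (intro divide_left_mono) auto
        then have "2 * K * D * lam * (L + 1 / real (Suc (Suc n))) \<le> 2 * K * D * lam * (L + 1 / real (Suc n))"
          using c0 by (intro mult_left_mono) auto
        ultimately show "z \<in> A (Suc n)" unfolding A_def by auto
      qed
      have Un: "(\<Union>n. A n) = {z\<in>upper_half. 2 * K * D * lam * L < cmod (f z)}"
      proof (intro equalityI subsetI)
        fix z assume "z \<in> (\<Union>n. A n)"
        then obtain n where z: "z \<in> upper_half" "2 * K * D * lam * (L + 1 / Suc n) < cmod (f z)" by (auto simp: A_def)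
        have "2 * K * D * lam * L \<le> 2 * K * D * lam * (L + 1 / Suc n)" using c0 by (intro mult_left_mono) auto
        with z show "z \<in> {z\<in>upper_half. 2 * K * D * lam * L < cmod (f z)}" by auto
      next
        fix z assume z: "z \<in> {z\<in>upper_half. 2 * K * D * lam * L < cmod (f z)}"
        then have "0 < (cmod (f z) - 2 * K * D * lam * L) / (2 * K * D * lam)" using c0 by simp
        then obtain n where "inverse (real (Suc n)) < (cmod (f z) - 2 * K * D * lam * L) / (2 * K * D * lam)"
          using reals_Archimedean by blast
        then have "2 * K * D * lam * (L + 1 / Suc n) < cmod (f z)"
          using c0 by (simp add: pos_less_divide_eq inverse_eq_divide algebra_simps)
        with z show "z \<in> (\<Union>n. A n)" by (auto simp: A_def)
      qed
      have "ennreal (\<Phi>2 lam) * emeasure \<mu> (\<Union>n. A n) = (SUP n. ennreal (\<Phi>2 lam) * emeasure \<mu> (A n))"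
        by (simp add: SUP_emeasure_incseq[OF A inc, symmetric] SUP_mult_left_ennreal)
      also have "\<dots> \<le> 1"
        unfolding A_def using lam by (intro SUP_least main f) (auto simp: L_def)
      finally show "ennreal (\<Phi>2 lam) * emeasure \<mu> {z\<in>upper_half. 2 * K * D * lam * lux_norm \<Phi>1 \<alpha> f < cmod (f z)} \<le> 1"
        unfolding Un L_def .
    qed
  qed
  show ?A if ?B
  proof -
    from that obtain C where C: "0 < C" and weak: "\<And>f lam. f \<in> bergman_orlicz \<Phi>1 \<alpha> \<Longrightarrow> (\<exists>z\<in>upper_half. f z \<noteq> 0) \<Longrightarrow> 0 < lam \<Longrightarrow>
        ennreal (\<Phi>2 lam) * emeasure \<mu> {z\<in>upper_half. cmod (f z) > C * lam * lux_norm \<Phi>1 \<alpha> f} \<le> 1"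
      by blast
    obtain n :: nat where n: "\<alpha> + 1 < n" using reals_Archimedean2 by blast
    define K where "K = max 1 (pi * (1 / (\<alpha> + 1) + 1 / (n - \<alpha> - 1)))"
    have K: "1 \<le> K" by (simp add: K_def)
    \<comment> \<open>With \<open>lam = s / t\<close> the threshold \<open>C * lam * K\<close> must
      lie below \<open>s / 3 ^ (n + 2)\<close>, a lower bound for the test function on the box; the
      factor 2 makes this strict.\<close>
    define t where "t = max 1 (2 * C * K * 3 ^ (n + 2))"
    have t: "1 \<le> t" "2 * C * K * 3 ^ (n + 2) \<le> t" by (auto simp: t_def)
    \<comment> \<open>Used at \<open>lam\<close>: since \<open>s = lam * t\<close>, the value
      \<open>\<Phi>2 s\<close> is at most \<open>C' * \<Phi>2 lam\<close>.\<close>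
    obtain C' where C': "0 < C'" "\<And>s. 0 < s \<Longrightarrow> \<Phi>2 (s * t) \<le> C' * \<Phi>2 s"
      using class_U_upper_type[OF U2 t(1)] by blast
    have "emeasure \<mu> (carleson_box a b) \<le> ennreal (C' / \<Phi>2 (growth_inv \<Phi>1 (1 / (b - a) powr (2 + \<alpha>))))"
      if ab: "a < b" for a b
    proof -
      define h where "h = b - a"
      define T where "T = 1 / h powr (2 + \<alpha>)"
      define s where "s = growth_inv \<Phi>1 T"
      \<comment> \<open>The depth \<open>h\<close> keeps the distance to \<open>p\<close> at least
        \<open>h\<close> on the half plane, so \<open>f\<close> is bounded by \<open>s\<close>
        there, and at most \<open>3 * h\<close> on the box.\<close>
      define p where "p = Complex ((a + b) / 2) (- h)"
      define f where "f = (\<lambda>z. complex_of_real s * (complex_of_real h / (z - p)) ^ (n + 2))"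
      have h: "0 < h" using ab by (simp add: h_def)
      have T: "0 < T" using h by (simp add: T_def)
      have s: "0 < s" "\<Phi>1 s = T" using growth_inv[OF U1 T] by (auto simp: s_def)
      have ne: "z \<noteq> p" "h \<le> cmod (z - p)" if "z \<in> upper_half" for z
        using that h abs_Im_le_cmod[of "z - p"] by (auto simp: upper_half_def p_def)
      have nf: "cmod (f z) = s * (h / cmod (z - p)) ^ (n + 2)" for z
        using s h by (simp add: f_def norm_mult norm_power norm_divide)
      have hol: "f holomorphic_on upper_half"
        unfolding f_def using ne by (intro holomorphic_intros) auto
      have "orlicz_int \<Phi>1 \<alpha> f \<le> (\<integral>\<^sup>+z. ennreal T * (indicator upper_half z * ennreal (Im z powr \<alpha>) *
          ennreal ((h / cmod (z - p)) ^ (n + 2))) \<partial>lborel)"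
        unfolding orlicz_int_def
      proof (intro nn_integral_mono)
        fix z
        show "indicator upper_half z * ennreal (Im z powr \<alpha>) * ennreal (\<Phi>1 (cmod (f z))) \<le>
          ennreal T * (indicator upper_half z * ennreal (Im z powr \<alpha>) * ennreal ((h / cmod (z - p)) ^ (n + 2)))"
        proof (cases "z \<in> upper_half")
          case True
          \<comment> \<open>Contraction from \<open>s\<close>, where \<open>\<Phi>1\<close> equals
            \<open>T\<close>, extracts the power as a linear factor; \<open>T\<close> then cancels
            the scale \<open>h powr (2 + \<alpha>)\<close> of the integral.\<close>
          have "\<Phi>1 (cmod (f z)) \<le> (h / cmod (z - p)) ^ (n + 2) * T"
            using class_U_contract[OF U1, of s "(h / cmod (z - p)) ^ (n + 2)"] s h ne[OF True] power_le_one[of "h / cmod (z - p)" "n + 2"]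
            by (simp add: nf mult.commute)
          then have "ennreal (\<Phi>1 (cmod (f z))) \<le> ennreal T * ennreal ((h / cmod (z - p)) ^ (n + 2))"
            using T by (subst ennreal_mult'[symmetric]) (auto intro!: ennreal_leI simp: mult.commute)
          then show ?thesis using True by (auto simp: mult.left_commute[of "ennreal T"] intro!: mult_left_mono)
        qed simp
      qed
      also have "\<dots> = ennreal T * (\<integral>\<^sup>+z. indicator upper_half z * ennreal (Im z powr \<alpha>) *
          ennreal ((h / cmod (z - p)) ^ (n + 2)) \<partial>lborel)"
      proof (rule nn_integral_cmult)
        have [measurable]: "upper_half \<in> sets borel" by simp
        show "(\<lambda>z. indicator upper_half z * ennreal (Im z powr \<alpha>) * ennreal ((h / cmod (z - p)) ^ (n + 2))) \<in> borel_measurable lborel"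
          by measurable
      qed
      also have "\<dots> \<le> ennreal T * ennreal (pi * (1 / (\<alpha> + 1) + 1 / (n - \<alpha> - 1)) * h powr (2 + \<alpha>))"
        unfolding p_def by (intro mult_left_mono test_function_integral \<alpha> n h) auto
      also have "\<dots> = ennreal (pi * (1 / (\<alpha> + 1) + 1 / (n - \<alpha> - 1)))"
        using T h by (subst ennreal_mult'[symmetric]) (auto simp: T_def)
      also have "\<dots> \<le> ennreal K" by (intro ennreal_leI) (simp add: K_def)
      finally have int: "orlicz_int \<Phi>1 \<alpha> f \<le> ennreal K" .
      then have fB: "f \<in> bergman_orlicz \<Phi>1 \<alpha>"
        using hol by (auto simp: bergman_orlicz_def intro: le_less_trans)
      have "orlicz_int \<Phi>1 \<alpha> (\<lambda>z. f z / complex_of_real K) \<le> ennreal (1 / K) * orlicz_int \<Phi>1 \<alpha> f"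
        using orlicz_int_divide_le[OF U1 holomorphic_on_imp_continuous_on[OF hol] K] .
      also have "\<dots> \<le> ennreal (1 / K) * ennreal K" by (intro mult_left_mono int) auto
      also have "\<dots> = 1" using K by (subst ennreal_mult'[symmetric]) auto
      finally have lux: "lux_norm \<Phi>1 \<alpha> f \<le> K" using K by (intro lux_norm_le) auto
      have nz: "\<exists>z\<in>upper_half. f z \<noteq> 0"
        using s h ne[of \<i>] by (intro bexI[of _ \<i>]) (auto simp: f_def upper_half_def)
      define lam where "lam = s / t"
      have lam: "0 < lam" using s t by (simp add: lam_def)
      have sub: "carleson_box a b \<subseteq> {z\<in>upper_half. cmod (f z) > C * lam * lux_norm \<Phi>1 \<alpha> f}"
      proof
        fix z assume z: "z \<in> carleson_box a b"
        then have zU: "z \<in> upper_half" by (auto simp: carleson_box_def upper_half_def)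
        \<comment> \<open>Half the interval length would do horizontally; vertically the box height
          adds to the depth of \<open>p\<close>.\<close>
        have "\<bar>Re (z - p)\<bar> \<le> h" "\<bar>Im (z - p)\<bar> \<le> 2 * h"
          using z by (auto simp: carleson_box_def p_def h_def abs_le_iff field_simps)
        then have "cmod (z - p) \<le> 3 * h" using cmod_le[of "z - p"] by linarith
        then have "1 / 3 \<le> h / cmod (z - p)" using h ne[OF zU] by (simp add: field_simps)
        then have "(1 / 3) ^ (n + 2) \<le> (h / cmod (z - p)) ^ (n + 2)" by (intro power_mono) auto
        then have low: "s * (1 / 3) ^ (n + 2) \<le> cmod (f z)" unfolding nf using s by (intro mult_left_mono) auto
        have "C * lam * lux_norm \<Phi>1 \<alpha> f \<le> C * lam * K" using lux C lam by (intro mult_left_mono) auto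
        also have "C * lam * K = s * (C * K / t)" by (simp add: lam_def)
        also have "\<dots> < s * (1 / 3) ^ (n + 2)"
        proof (intro mult_strict_left_mono)
          have "0 < C * K * 3 ^ (n + 2)" using C K by simp
          then have "C * K * 3 ^ (n + 2) < t" using t by linarith
          then show "C * K / t < (1 / 3) ^ (n + 2)" using t by (simp add: field_simps power_one_over)
        qed (use s in auto)
        finally show "z \<in> {z\<in>upper_half. cmod (f z) > C * lam * lux_norm \<Phi>1 \<alpha> f}" using low zU by auto
      qed
      have "open {z\<in>upper_half. cmod (f z) > C * lam * lux_norm \<Phi>1 \<alpha> f}"
        by (intro open_level_set holomorphic_on_imp_continuous_on hol)
      then have "emeasure \<mu> (carleson_box a b) \<le> emeasure \<mu> {z\<in>upper_half. cmod (f z) > C * lam * lux_norm \<Phi>1 \<alpha> f}"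
        using \<mu> by (intro emeasure_mono sub) auto
      then have le1: "ennreal (\<Phi>2 lam) * emeasure \<mu> (carleson_box a b) \<le> 1"
        using weak[OF fB nz lam] by (meson mult_left_mono order_trans zero_le)
      have p2: "0 < \<Phi>2 lam" "0 < \<Phi>2 s" using class_U_pos[OF U2] lam s by auto
      have "emeasure \<mu> (carleson_box a b) = ennreal (1 / \<Phi>2 lam) * (ennreal (\<Phi>2 lam) * emeasure \<mu> (carleson_box a b))"
        using p2 by (simp add: mult.assoc[symmetric] ennreal_mult'[symmetric])
      also have "\<dots> \<le> ennreal (1 / \<Phi>2 lam) * 1" by (intro mult_left_mono le1) auto
      also have "\<dots> \<le> ennreal (C' / \<Phi>2 s)"
        using C'(2)[OF lam] p2 t by (auto simp: lam_def field_simps intro!: ennreal_leI)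
      finally show ?thesis by (simp add: s_def T_def h_def)
    qed
    then show ?A using C'(1) by blast
  qed
qed

end
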